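(* Let $X$ be a compact Hausdorff space, let $A$ be a commutative Banach algebra, and let $\sigma:A\to A$ be a continuous algebra homomorphism with dense range. Suppose that there is a bounded net $(e_v)$ in $A$ such that $(\sigma(e_v))$ is a bounded approximate identity for $A$. Let $\tilde{\sigma}:C(X,A)\to C(X,A)$ be the continuous homomorphism $\tilde{\sigma}(f):=\sigma\circ f$. If $A$ is $\sigma$-weakly amenable, then $C(X,A)$ is $\tilde{\sigma}$-weakly amenable.
   Context: $C(X,A)$ denotes the Banach algebra of all continuous functions $X\to A$ with pointwise operations and norm $\|f\|_\infty=\sup_{x\in X}\|f(x)\|$. Let $B$ be a Banach algebra, $\theta:B\to B$ a continuous homomorphism and $E$ a Banach $B$-bimodule. A $\theta$-derivation is a bounded linear map $D:B\to E$ with $D(ab)=D(a)\cdot\theta(b)+\theta(a)\cdot D(b)$ for all $a,b\in B$. It is $\theta$-inner if there is $x\in E$ with $D(a)=\theta(a)\cdot x-x\cdot\theta(a)$ for all $a\in B$. $B$ is $\theta$-weakly amenable if every $\theta$-derivation $D:B\to B^*$ is $\theta$-inner, where $B^*$ carries the usual dual bimodule structure. *)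

theory Defs
  imports "HOL-Analysis.Analysis"
begin

section \<open>Complex Banach algebras\<close>

text \<open>
  Banach algebras are over the complex field, and neither a unit nor commutativity is built in.
  The library classes \<^class>\<open>real_normed_vector\<close>, \<^class>\<open>banach\<close> and \<^class>\<open>real_normed_algebra\<close>
  know real scalars only, so they are extended by a compatible complex scalar multiplication.
\<close>

class scaleC =
  fixes scaleC :: "complex \<Rightarrow> 'a \<Rightarrow> 'a"  (infixr \<open>*\<^sub>C\<close> 75)

class complex_normed_vector = real_normed_vector + scaleC +
  assumes scaleC_add_right: "c *\<^sub>C (x + y) = c *\<^sub>C x + c *\<^sub>C y"
    and scaleC_add_left: "(c + d) *\<^sub>C x = c *\<^sub>C x + d *\<^sub>C x"
    and scaleC_scaleC: "c *\<^sub>C d *\<^sub>C x = (c * d) *\<^sub>C x"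
    and scaleC_of_real: "complex_of_real r *\<^sub>C x = r *\<^sub>R x"
    and norm_scaleC: "norm (c *\<^sub>C x) = cmod c * norm x"

class complex_banach = complex_normed_vector + banach

class complex_banach_algebra = complex_banach + real_normed_algebra +
  assumes mult_scaleC_left: "(c *\<^sub>C x) * y = c *\<^sub>C (x * y)"
    and mult_scaleC_right: "x * (c *\<^sub>C y) = c *\<^sub>C (x * y)"

lemma vector_space_scaleC: "vector_space (scaleC :: complex \<Rightarrow> 'a::complex_normed_vector \<Rightarrow> 'a)"
proof
  fix x :: 'a
  show "1 *\<^sub>C x = x"
    using scaleC_of_real[of 1 x] by simp
qed (simp_all add: scaleC_add_right scaleC_add_left scaleC_scaleC)

instantiation complex :: complex_banach_algebra
begin

definition scaleC_complex :: "complex \<Rightarrow> complex \<Rightarrow> complex"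
  where "scaleC_complex c z = c * z"

instance
  by standard (simp_all add: scaleC_complex_def algebra_simps norm_mult scaleR_conv_of_real)

end

section \<open>Linear maps and homomorphisms\<close>

abbreviation clinear :: "('a::complex_normed_vector \<Rightarrow> 'b::complex_normed_vector) \<Rightarrow> bool"
  where "clinear \<equiv> Vector_Spaces.linear scaleC scaleC"

definition bounded_clinear :: "('a::complex_normed_vector \<Rightarrow> 'b::complex_normed_vector) \<Rightarrow> bool"
  where "bounded_clinear f \<longleftrightarrow> clinear f \<and> (\<exists>K. \<forall>x. norm (f x) \<le> K * norm x)"

definition continuous_algebra_hom ::
    "('a::complex_banach_algebra \<Rightarrow> 'b::complex_banach_algebra) \<Rightarrow> bool"
  where "continuous_algebra_hom \<theta> \<longleftrightarrow>
    clinear \<theta> \<and> (\<forall>a b. \<theta> (a * b) = \<theta> a * \<theta> b) \<and> continuous_on UNIV \<theta>"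

lemma clinear_iff:
  "clinear f \<longleftrightarrow> (\<forall>x y. f (x + y) = f x + f y) \<and> (\<forall>c x. f (c *\<^sub>C x) = c *\<^sub>C f x)"
  by (simp add: Vector_Spaces.linear_iff vector_space_scaleC)

lemma clinear_imp_linear:
  assumes "clinear f"
  shows "linear f"
proof (rule linearI)
  fix r x y
  show "f (x + y) = f x + f y"
    using assms by (simp add: clinear_iff)
  show "f (r *\<^sub>R x) = r *\<^sub>R f x"
    using assms by (simp add: clinear_iff flip: scaleC_of_real)
qed

lemma bounded_clinear_iff:
  "bounded_clinear f \<longleftrightarrow> bounded_linear f \<and> (\<forall>c x. f (c *\<^sub>C x) = c *\<^sub>C f x)"
proof
  assume f: "bounded_clinear f"
  then obtain K where "\<forall>x. norm (f x) \<le> K * norm x"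
    by (auto simp: bounded_clinear_def)
  then have "bounded_linear f"
    using clinear_imp_linear[of f] f
    by (auto simp: bounded_clinear_def bounded_linear_def bounded_linear_axioms_def mult.commute)
  then show "bounded_linear f \<and> (\<forall>c x. f (c *\<^sub>C x) = c *\<^sub>C f x)"
    using f by (simp add: bounded_clinear_def clinear_iff)
next
  assume f: "bounded_linear f \<and> (\<forall>c x. f (c *\<^sub>C x) = c *\<^sub>C f x)"
  then interpret bounded_linear f by simp
  from f show "bounded_clinear f"
    using bounded by (auto simp: bounded_clinear_def clinear_iff add mult.commute)
qed

lemma continuous_algebra_hom_imp_bounded_linear:
  assumes "continuous_algebra_hom \<theta>"
  shows "bounded_linear \<theta>"
proof -
  have lin: "linear \<theta>" and cont: "continuous_on UNIV \<theta>"
    using assms by (auto simp: continuous_algebra_hom_def clinear_imp_linear)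
  obtain d where d: "d > 0" "\<And>y. norm y < d \<Longrightarrow> norm (\<theta> y) < 1"
    using cont linear_0[OF lin] unfolding continuous_on_iff
    by (metis UNIV_I dist_0_norm dist_commute zero_less_one)
  have "norm (\<theta> x) \<le> norm x * (2 / d)" for x
  proof (cases "x = 0")
    case True
    then show ?thesis using linear_0[OF lin] by simp
  next
    case False
    define r where "r = d / (2 * norm x)"
    have r: "r > 0" using False d(1) by (simp add: r_def)
    have "norm (r *\<^sub>R x) < d" using False d(1) by (simp add: r_def)
    from d(2)[OF this] have "r * norm (\<theta> x) < 1"
      using r by (simp add: linear_scale[OF lin])
    then show ?thesis using r False d(1) by (simp add: r_def field_simps)
  qed
  then show ?thesis
    using lin unfolding bounded_linear_def bounded_linear_axioms_def by blast
qed

section \<open>The dual of a complex normed space\<close>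

typedef (overloaded) 'a cdual = "{\<phi> :: 'a::complex_normed_vector \<Rightarrow> complex. bounded_clinear \<phi>}"
  morphisms cdual_apply Cdual
  by (rule exI[of _ "\<lambda>_. 0"]) (simp add: bounded_clinear_iff scaleC_complex_def)

setup_lifting type_definition_cdual

lemma bounded_linear_cdual_apply: "bounded_linear (cdual_apply \<phi>)"
  using cdual_apply[of \<phi>] by (simp add: bounded_clinear_iff)

lemma cdual_apply_scaleC: "cdual_apply \<phi> (c *\<^sub>C x) = c * cdual_apply \<phi> x"
  using cdual_apply[of \<phi>] by (simp add: bounded_clinear_iff scaleC_complex_def)

lemma cdual_eqI: "(\<And>x. cdual_apply \<phi> x = cdual_apply \<psi> x) \<Longrightarrow> \<phi> = \<psi>"
  by transfer auto

instantiation cdual :: (complex_normed_vector) complex_normed_vector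
begin

lift_definition norm_cdual :: "'a cdual \<Rightarrow> real" is onorm .

lift_definition zero_cdual :: "'a cdual" is "\<lambda>_. 0"
  by (simp add: bounded_clinear_iff scaleC_complex_def)

lift_definition plus_cdual :: "'a cdual \<Rightarrow> 'a cdual \<Rightarrow> 'a cdual" is "\<lambda>\<phi> \<psi> x. \<phi> x + \<psi> x"
  by (simp add: bounded_clinear_iff bounded_linear_add scaleC_add_right)

lift_definition minus_cdual :: "'a cdual \<Rightarrow> 'a cdual \<Rightarrow> 'a cdual" is "\<lambda>\<phi> \<psi> x. \<phi> x - \<psi> x"
  by (simp add: bounded_clinear_iff bounded_linear_sub scaleC_complex_def algebra_simps)

lift_definition uminus_cdual :: "'a cdual \<Rightarrow> 'a cdual" is "\<lambda>\<phi> x. - \<phi> x"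
  by (simp add: bounded_clinear_iff bounded_linear_minus scaleC_complex_def)

lift_definition scaleR_cdual :: "real \<Rightarrow> 'a cdual \<Rightarrow> 'a cdual" is "\<lambda>r \<phi> x. r *\<^sub>R \<phi> x"
  by (simp add: bounded_clinear_iff scaleC_complex_def
      bounded_linear_compose[OF bounded_linear_scaleR_right])

lift_definition scaleC_cdual :: "complex \<Rightarrow> 'a cdual \<Rightarrow> 'a cdual" is "\<lambda>c \<phi> x. c * \<phi> x"
  by (simp add: bounded_clinear_iff scaleC_complex_def
      bounded_linear_compose[OF bounded_linear_mult_right])

definition dist_cdual :: "'a cdual \<Rightarrow> 'a cdual \<Rightarrow> real"
  where "dist_cdual \<phi> \<psi> = norm (\<phi> - \<psi>)"

definition sgn_cdual :: "'a cdual \<Rightarrow> 'a cdual"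
  where "sgn_cdual \<phi> = inverse (norm \<phi>) *\<^sub>R \<phi>"

definition uniformity_cdual :: "('a cdual \<times> 'a cdual) filter"
  where "uniformity_cdual = (INF e\<in>{0 <..}. principal {(x, y). dist x y < e})"

definition open_cdual :: "'a cdual set \<Rightarrow> bool"
  where "open_cdual S = (\<forall>x\<in>S. \<forall>\<^sub>F (x', y) in uniformity. x' = x \<longrightarrow> y \<in> S)"

instance
proof
  fix \<phi> \<psi> :: "'a cdual" and r :: real and c :: complex
  show "norm (r *\<^sub>R \<phi>) = \<bar>r\<bar> * norm \<phi>"
    by transfer (simp add: onorm_scaleR bounded_clinear_iff)
  show rC: "complex_of_real r *\<^sub>C \<phi> = r *\<^sub>R \<phi>"
    by transfer (simp add: scaleR_conv_of_real)
  show "norm (\<phi> + \<psi>) \<le> norm \<phi> + norm \<psi>"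
    by transfer (simp add: onorm_triangle bounded_clinear_iff)
  show "(norm \<phi> = 0) = (\<phi> = 0)"
    by transfer (auto simp: onorm_eq_0 bounded_clinear_iff)
  have le: "norm (d *\<^sub>C \<xi>) \<le> cmod d * norm \<xi>" for d and \<xi> :: "'a cdual"
  proof transfer
    fix d and \<xi> :: "'a \<Rightarrow> complex"
    assume "bounded_clinear \<xi>"
    then have b: "bounded_linear \<xi>" by (simp add: bounded_clinear_iff)
    show "onorm (\<lambda>x. d * \<xi> x) \<le> cmod d * onorm \<xi>"
    proof (rule onorm_bound)
      show "norm (d * \<xi> x) \<le> cmod d * onorm \<xi> * norm x" for x
        using mult_left_mono[OF onorm[OF b, of x], of "cmod d"] by (simp add: norm_mult mult.assoc)
    qed (simp add: onorm_pos_le[OF b])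
  qed
  show "norm (c *\<^sub>C \<phi>) = cmod c * norm \<phi>"
  proof (rule antisym[OF le])
    show "cmod c * norm \<phi> \<le> norm (c *\<^sub>C \<phi>)"
    proof (cases "c = 0")
      case True
      have "0 \<le> norm (c *\<^sub>C \<phi>)"
        by transfer (simp add: bounded_clinear_iff onorm_pos_le
            bounded_linear_compose[OF bounded_linear_mult_right])
      then show ?thesis using True by simp
    next
      case False
      have "inverse c *\<^sub>C (c *\<^sub>C \<phi>) = \<phi>"
        using False by transfer (simp add: mult.assoc[symmetric])
      then have "norm \<phi> \<le> inverse (cmod c) * norm (c *\<^sub>C \<phi>)"
        using le[of "inverse c" "c *\<^sub>C \<phi>"] unfolding norm_inverse by simp
      then show ?thesis using False by (simp add: field_simps)
    qed
  qed
qed (unfold dist_cdual_def sgn_cdual_def uniformity_cdual_def open_cdual_def,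
    (rule refl | (transfer, force simp: algebra_simps))+)

end

lemma norm_cdual: "cmod (cdual_apply \<phi> x) \<le> norm \<phi> * norm x"
  by transfer (simp add: onorm bounded_clinear_iff)

lemma norm_cdual_bound:
  "0 \<le> b \<Longrightarrow> (\<And>x. cmod (cdual_apply \<phi> x) \<le> b * norm x) \<Longrightarrow> norm \<phi> \<le> b"
  by transfer (rule onorm_bound)

instance cdual :: (complex_normed_vector) complex_banach
proof
  fix X :: "nat \<Rightarrow> 'a cdual"
  assume X: "Cauchy X"
  define Y where "Y n = Blinfun (cdual_apply (X n))" for n
  have Y: "blinfun_apply (Y n) x = cdual_apply (X n) x" for n x
    by (simp add: Y_def bounded_linear_Blinfun_apply bounded_linear_cdual_apply)
  have norm_Y: "norm (Y m - Y n) = norm (X m - X n)" for m n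
  proof (rule antisym)
    have eq: "blinfun_apply (Y m - Y n) x = cdual_apply (X m - X n) x" for x
      by (simp add: Y blinfun.diff_left minus_cdual.rep_eq)
    show "norm (Y m - Y n) \<le> norm (X m - X n)"
      by (rule norm_blinfun_bound) (simp_all only: eq norm_cdual norm_ge_zero)
    show "norm (X m - X n) \<le> norm (Y m - Y n)"
      by (rule norm_cdual_bound) (simp_all only: eq[symmetric] norm_blinfun norm_ge_zero)
  qed
  have "Cauchy Y"
    using X by (simp add: Cauchy_iff norm_Y)
  then obtain l where l: "Y \<longlonglongrightarrow> l"
    using Cauchy_convergent[of Y] unfolding convergent_def by auto
  have lim: "(\<lambda>n. cdual_apply (X n) x) \<longlonglongrightarrow> blinfun_apply l x" for x
    using blinfun.tendsto[OF l tendsto_const[of x]] by (simp add: Y)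
  have "blinfun_apply l (c *\<^sub>C x) = c * blinfun_apply l x" for c x
  proof (rule LIMSEQ_unique[OF lim])
    show "(\<lambda>n. cdual_apply (X n) (c *\<^sub>C x)) \<longlonglongrightarrow> c * blinfun_apply l x"
      unfolding cdual_apply_scaleC by (rule tendsto_mult_left[OF lim])
  qed
  then have "bounded_clinear (blinfun_apply l)"
    by (simp add: bounded_clinear_iff scaleC_complex_def blinfun.bounded_linear_right)
  then have L: "cdual_apply (Cdual (blinfun_apply l)) = blinfun_apply l"
    by (simp add: Cdual_inverse)
  have "norm (X n - Cdual (blinfun_apply l)) \<le> norm (Y n - l)" for n
  proof (rule norm_cdual_bound)
    show "cmod (cdual_apply (X n - Cdual (blinfun_apply l)) x) \<le> norm (Y n - l) * norm x" for x
      using norm_blinfun[of "Y n - l" x] by (simp add: L Y blinfun.diff_left minus_cdual.rep_eq)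
  qed simp
  then have "dist (X n) (Cdual (blinfun_apply l)) \<le> dist (Y n) l" for n
    by (simp only: dist_norm)
  then have "X \<longlonglongrightarrow> Cdual (blinfun_apply l)"
    by (intro metric_tendsto_imp_tendsto[OF l] always_eventually allI)
  then show "convergent X"
    by (rule convergentI)
qed

section \<open>Banach bimodules, derivations and weak amenability\<close>

locale banach_bimodule =
  fixes lact :: "'b::complex_banach_algebra \<Rightarrow> 'e::complex_banach \<Rightarrow> 'e"
    and ract :: "'e \<Rightarrow> 'b \<Rightarrow> 'e"
  assumes bounded_bilinear_lact: "bounded_bilinear lact"
    and bounded_bilinear_ract: "bounded_bilinear ract"
    and lact_scaleC_left: "lact (c *\<^sub>C a) x = c *\<^sub>C lact a x"
    and lact_scaleC_right: "lact a (c *\<^sub>C x) = c *\<^sub>C lact a x"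
    and ract_scaleC_left: "ract (c *\<^sub>C x) a = c *\<^sub>C ract x a"
    and ract_scaleC_right: "ract x (c *\<^sub>C a) = c *\<^sub>C ract x a"
    and lact_mult: "lact (a * b) x = lact a (lact b x)"
    and ract_mult: "ract x (a * b) = ract (ract x a) b"
    and lact_ract: "ract (lact a x) b = lact a (ract x b)"

text \<open>
  \<open>\<theta>\<close>-derivations, \<open>\<theta>\<close>-inner derivations and \<open>\<theta>\<close>-weak amenability, for a continuous homomorphism
  \<open>\<theta>\<close>. The bimodule is given by its two actions, as in \<^locale>\<open>banach_bimodule\<close>.
\<close>

definition twisted_derivation ::
    "('b::complex_banach_algebra \<Rightarrow> 'e::complex_banach \<Rightarrow> 'e) \<Rightarrow> ('e \<Rightarrow> 'b \<Rightarrow> 'e) \<Rightarrow>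
     ('b \<Rightarrow> 'b) \<Rightarrow> ('b \<Rightarrow> 'e) \<Rightarrow> bool"
  where "twisted_derivation lact ract \<theta> D \<longleftrightarrow>
    bounded_clinear D \<and> (\<forall>a b. D (a * b) = ract (D a) (\<theta> b) + lact (\<theta> a) (D b))"

definition twisted_inner ::
    "('b::complex_banach_algebra \<Rightarrow> 'e::complex_banach \<Rightarrow> 'e) \<Rightarrow> ('e \<Rightarrow> 'b \<Rightarrow> 'e) \<Rightarrow>
     ('b \<Rightarrow> 'b) \<Rightarrow> ('b \<Rightarrow> 'e) \<Rightarrow> bool"
  where "twisted_inner lact ract \<theta> D \<longleftrightarrow> (\<exists>x. \<forall>a. D a = lact (\<theta> a) x - ract x (\<theta> a))"

lift_definition dual_lact :: "'b::complex_banach_algebra \<Rightarrow> 'b cdual \<Rightarrow> 'b cdual"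
  is "\<lambda>a \<phi> b. \<phi> (b * a)"
  by (simp add: bounded_clinear_iff mult_scaleC_left
      bounded_linear_compose[OF _ bounded_linear_mult_left])

lift_definition dual_ract :: "'b::complex_banach_algebra cdual \<Rightarrow> 'b \<Rightarrow> 'b cdual"
  is "\<lambda>\<phi> a b. \<phi> (a * b)"
  by (simp add: bounded_clinear_iff mult_scaleC_right
      bounded_linear_compose[OF _ bounded_linear_mult_right])

lemma banach_bimodule_dual: "banach_bimodule dual_lact dual_ract"
proof
  note add = linear_add[OF bounded_linear.linear[OF bounded_linear_cdual_apply]]
  note scale = linear_scale[OF bounded_linear.linear[OF bounded_linear_cdual_apply]]
  fix a b :: 'a and \<phi> \<psi> :: "'a cdual" and r :: real and c :: complex
  show "dual_lact (a + b) \<phi> = dual_lact a \<phi> + dual_lact b \<phi>"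
    "dual_lact a (\<phi> + \<psi>) = dual_lact a \<phi> + dual_lact a \<psi>"
    "dual_lact (r *\<^sub>R a) \<phi> = r *\<^sub>R dual_lact a \<phi>"
    "dual_lact a (r *\<^sub>R \<phi>) = r *\<^sub>R dual_lact a \<phi>"
    "dual_lact (c *\<^sub>C a) \<phi> = c *\<^sub>C dual_lact a \<phi>"
    "dual_lact a (c *\<^sub>C \<phi>) = c *\<^sub>C dual_lact a \<phi>"
    "dual_lact (a * b) \<phi> = dual_lact a (dual_lact b \<phi>)"
    "dual_ract (\<phi> + \<psi>) a = dual_ract \<phi> a + dual_ract \<psi> a"
    "dual_ract \<phi> (a + b) = dual_ract \<phi> a + dual_ract \<phi> b"
    "dual_ract (r *\<^sub>R \<phi>) a = r *\<^sub>R dual_ract \<phi> a"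
    "dual_ract \<phi> (r *\<^sub>R a) = r *\<^sub>R dual_ract \<phi> a"
    "dual_ract (c *\<^sub>C \<phi>) a = c *\<^sub>C dual_ract \<phi> a"
    "dual_ract \<phi> (c *\<^sub>C a) = c *\<^sub>C dual_ract \<phi> a"
    "dual_ract \<phi> (a * b) = dual_ract (dual_ract \<phi> a) b"
    "dual_ract (dual_lact a \<phi>) b = dual_lact a (dual_ract \<phi> b)"
    by (auto intro!: cdual_eqI
        simp: dual_lact.rep_eq dual_ract.rep_eq plus_cdual.rep_eq scaleR_cdual.rep_eq
          scaleC_cdual.rep_eq cdual_apply_scaleC mult_scaleC_left mult_scaleC_right
          add scale distrib_left distrib_right mult.assoc)
next
  have *: "cmod (cdual_apply \<phi> z) \<le> norm \<phi> * norm a * norm b"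
    if "norm z \<le> norm a * norm b" for a b z :: 'a and \<phi>
    using order_trans[OF norm_cdual[of \<phi> z] mult_left_mono[OF that, of "norm \<phi>"]]
    by (simp add: mult.assoc)
  have "norm (dual_lact a \<phi>) \<le> norm \<phi> * norm a" for a :: 'a and \<phi>
  proof (rule norm_cdual_bound)
    show "cmod (cdual_apply (dual_lact a \<phi>) b) \<le> norm \<phi> * norm a * norm b" for b
      using *[of "b * a" a b] norm_mult_ineq[of b a]
      by (simp add: dual_lact.rep_eq mult.commute[of "norm a"])
  qed simp
  then show "\<exists>K. \<forall>(a::'a) \<phi>. norm (dual_lact a \<phi>) \<le> norm a * norm \<phi> * K"
    by (intro exI[of _ 1]) (simp add: mult.commute)
  have "norm (dual_ract \<phi> a) \<le> norm \<phi> * norm a" for a :: 'a and \<phi>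
  proof (rule norm_cdual_bound)
    show "cmod (cdual_apply (dual_ract \<phi> a) b) \<le> norm \<phi> * norm a * norm b" for b
      using *[of "a * b" a b] norm_mult_ineq[of a b] by (simp add: dual_ract.rep_eq)
  qed simp
  then show "\<exists>K. \<forall>\<phi> (a::'a). norm (dual_ract \<phi> a) \<le> norm \<phi> * norm a * K"
    by (intro exI[of _ 1]) simp
qed

definition twisted_weakly_amenable :: "('b::complex_banach_algebra \<Rightarrow> 'b) \<Rightarrow> bool"
  where "twisted_weakly_amenable \<theta> \<longleftrightarrow>
    (\<forall>D :: 'b \<Rightarrow> 'b cdual.
      twisted_derivation dual_lact dual_ract \<theta> D \<longrightarrow> twisted_inner dual_lact dual_ract \<theta> D)"

section \<open>Nets and bounded approximate identities\<close>

definition directed_set :: "'i set \<Rightarrow> ('i \<Rightarrow> 'i \<Rightarrow> bool) \<Rightarrow> bool"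
  where "directed_set I le \<longleftrightarrow> I \<noteq> {} \<and> (\<forall>i\<in>I. le i i) \<and>
    (\<forall>i\<in>I. \<forall>j\<in>I. \<forall>k\<in>I. le i j \<longrightarrow> le j k \<longrightarrow> le i k) \<and>
    (\<forall>i\<in>I. \<forall>j\<in>I. \<exists>k\<in>I. le i k \<and> le j k)"

text \<open>Convergence of a net is convergence along the filter generated by the tails of its index set.\<close>

definition net_filter :: "'i set \<Rightarrow> ('i \<Rightarrow> 'i \<Rightarrow> bool) \<Rightarrow> 'i filter"
  where "net_filter I le = (INF i\<in>I. principal {j \<in> I. le i j})"

lemma eventually_net_filter:
  assumes "directed_set I le"
  shows "eventually P (net_filter I le) \<longleftrightarrow> (\<exists>i\<in>I. \<forall>j\<in>I. le i j \<longrightarrow> P j)"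
proof -
  have "eventually P (net_filter I le) \<longleftrightarrow> (\<exists>i\<in>I. eventually P (principal {j \<in> I. le i j}))"
    unfolding net_filter_def
  proof (rule eventually_INF_base)
    show "I \<noteq> {}" using assms by (simp add: directed_set_def)
    fix i j assume ij: "i \<in> I" "j \<in> I"
    then obtain k where k: "k \<in> I" "le i k" "le j k"
      using assms unfolding directed_set_def by blast
    have "{l \<in> I. le k l} \<subseteq> {l \<in> I. le i l} \<inter> {l \<in> I. le j l}"
      using assms ij k unfolding directed_set_def by blast
    then show "\<exists>x\<in>I. principal {j \<in> I. le x j} \<le>
        inf (principal {j \<in> I. le i j}) (principal {l \<in> I. le j l})"
      using k(1) by auto
  qed
  then show ?thesis
    by (auto simp: eventually_principal)
qed

definition bounded_approximate_identity ::
    "'i set \<Rightarrow> ('i \<Rightarrow> 'i \<Rightarrow> bool) \<Rightarrow> ('i \<Rightarrow> 'a::complex_banach_algebra) \<Rightarrow> bool"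
  where "bounded_approximate_identity I le u \<longleftrightarrow> bounded (u ` I) \<and>
    (\<forall>a. ((\<lambda>v. u v * a) \<longlongrightarrow> a) (net_filter I le) \<and> ((\<lambda>v. a * u v) \<longlongrightarrow> a) (net_filter I le))"

section \<open>The Banach algebra of continuous functions on a compact space\<close>

text \<open>
  For compact \<open>X\<close> every continuous function on \<open>X\<close> is bounded, so the library type of bounded
  continuous functions, normed by the supremum norm, is the space of all continuous functions.
\<close>

lemma compact_imp_bcontfun:
  fixes f :: "'x::topological_space \<Rightarrow> 'a::metric_space"
  assumes "compact (UNIV :: 'x set)" "continuous_on UNIV f"
  shows "f \<in> bcontfun"
  using compact_imp_bounded[OF compact_continuous_image[OF assms(2,1)]] assms(2)
  by (simp add: bcontfun_def)

lemma norm_bcontfun_eq_SUP: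
  fixes f :: "'x::topological_space \<Rightarrow>\<^sub>C 'a::real_normed_vector"
  shows "norm f = (SUP x. norm (apply_bcontfun f x))"
  by (simp add: norm_bcontfun_def dist_bcontfun.rep_eq)

text \<open>The library has this instance for metric domains only.\<close>

instance bcontfun :: (topological_space, complete_space) complete_space
proof
  fix f :: "nat \<Rightarrow> ('a, 'b) bcontfun"
  assume "Cauchy f"
  then obtain g where "uniform_limit UNIV f g sequentially"
    using uniformly_convergent_eq_cauchy[of "\<lambda>_. True" f]
    unfolding Cauchy_def uniform_limit_sequentially_iff
    by (metis dist_fun_lt_imp_dist_val_lt)
  from uniform_limit_bcontfunE[OF this sequentially_bot]
  obtain l' where "g = apply_bcontfun l'" "f \<longlonglongrightarrow> l'" by metis
  then show "convergent f"
    by (intro convergentI)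
qed

instance bcontfun :: (topological_space, banach) banach ..

unbundle bcontfun.lifting

instantiation bcontfun :: (topological_space, real_normed_algebra) real_normed_algebra
begin

lift_definition times_bcontfun :: "('a \<Rightarrow>\<^sub>C 'b) \<Rightarrow> ('a \<Rightarrow>\<^sub>C 'b) \<Rightarrow> 'a \<Rightarrow>\<^sub>C 'b"
  is "\<lambda>f g x. f x * g x"
proof -
  fix f g :: "'a \<Rightarrow> 'b"
  assume f: "f \<in> bcontfun" and g: "g \<in> bcontfun"
  obtain K L where K: "\<And>x. norm (f x) \<le> K" and L: "\<And>x. norm (g x) \<le> L"
    using f g by (auto simp: bcontfun_def bounded_iff)
  have "norm (f x * g x) \<le> K * L" for x
    using norm_mult_ineq[of "f x" "g x"] mult_mono'[OF K[of x] L[of x]] by simp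
  then show "(\<lambda>x. f x * g x) \<in> bcontfun"
    using f g by (intro bcontfun_normI[where b = "K * L"])
      (auto simp: bcontfun_def intro!: continuous_intros)
qed

instance
proof
  fix f g h :: "'a \<Rightarrow>\<^sub>C 'b" and r :: real
  show "norm (f * g) \<le> norm f * norm g"
  proof (rule norm_bound)
    show "norm (apply_bcontfun (f * g) x) \<le> norm f * norm g" for x
      using norm_mult_ineq[of "f x" "g x"]
        mult_mono'[OF norm_bounded[of f x] norm_bounded[of g x]]
      by (simp add: times_bcontfun.rep_eq)
  qed
qed (auto intro!: bcontfun_eqI simp: times_bcontfun.rep_eq algebra_simps)

end

instantiation bcontfun :: (topological_space, complex_normed_vector) complex_normed_vector
begin

lift_definition scaleC_bcontfun :: "complex \<Rightarrow> ('a \<Rightarrow>\<^sub>C 'b) \<Rightarrow> 'a \<Rightarrow>\<^sub>C 'b"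
  is "\<lambda>c f x. c *\<^sub>C f x"
proof -
  fix c and f :: "'a \<Rightarrow> 'b"
  assume f: "f \<in> bcontfun"
  have b: "bounded_linear ((*\<^sub>C) c :: 'b \<Rightarrow> 'b)"
  proof (rule bounded_linear_intro[where K = "cmod c"])
    show "c *\<^sub>C r *\<^sub>R x = r *\<^sub>R c *\<^sub>C x" for r and x :: 'b
      unfolding scaleC_of_real[symmetric] scaleC_scaleC by (simp only: mult.commute)
  qed (simp_all add: scaleC_add_right norm_scaleC)
  have "bounded ((*\<^sub>C) c ` range f)" "continuous_on UNIV (\<lambda>x. c *\<^sub>C f x)"
    using f bounded_linear_image[OF _ b] bounded_linear.continuous_on[OF b]
    by (auto simp: bcontfun_def)
  then show "(\<lambda>x. c *\<^sub>C f x) \<in> bcontfun"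
    by (simp add: bcontfun_def image_image)
qed

instance
proof
  fix f g :: "'a \<Rightarrow>\<^sub>C 'b" and c d :: complex and r :: real
  show "c *\<^sub>C (f + g) = c *\<^sub>C f + c *\<^sub>C g" "(c + d) *\<^sub>C f = c *\<^sub>C f + d *\<^sub>C f"
    "c *\<^sub>C d *\<^sub>C f = (c * d) *\<^sub>C f" "complex_of_real r *\<^sub>C f = r *\<^sub>R f"
    by (auto intro!: bcontfun_eqI simp: scaleC_bcontfun.rep_eq scaleC_add_right scaleC_add_left
        scaleC_scaleC scaleC_of_real)
  have le: "norm (d *\<^sub>C h) \<le> cmod d * norm h" for d and h :: "'a \<Rightarrow>\<^sub>C 'b"
    by (rule norm_bound) (auto simp: scaleC_bcontfun.rep_eq norm_scaleC norm_bounded mult_left_mono)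
  show "norm (c *\<^sub>C f) = cmod c * norm f"
  proof (cases "c = 0")
    case True
    then show ?thesis using le[of 0 f] by simp
  next
    case False
    have "inverse c *\<^sub>C c *\<^sub>C f = f"
      using False scaleC_of_real[where r = 1]
      by (auto intro!: bcontfun_eqI simp: scaleC_bcontfun.rep_eq scaleC_scaleC)
    then have "norm f \<le> inverse (cmod c) * norm (c *\<^sub>C f)"
      using le[of "inverse c" "c *\<^sub>C f"] unfolding norm_inverse by simp
    then have "cmod c * norm f \<le> norm (c *\<^sub>C f)"
      using False by (simp add: field_simps)
    with le[of c f] show ?thesis by simp
  qed
qed

end

instance bcontfun :: (topological_space, complex_banach) complex_banach ..

instance bcontfun :: (topological_space, complex_banach_algebra) complex_banach_algebra
  by standard (auto intro!: bcontfun_eqI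
      simp: times_bcontfun.rep_eq scaleC_bcontfun.rep_eq mult_scaleC_left mult_scaleC_right)

text \<open>
  The map \<open>f \<mapsto> \<sigma> \<circ> f\<close>. It is meaningful when \<open>\<sigma> \<circ> f\<close> is again bounded and continuous, in
  particular for every continuous homomorphism \<open>\<sigma>\<close>.
\<close>

definition pointwise_hom :: "('a::metric_space \<Rightarrow> 'b::metric_space) \<Rightarrow>
    ('x::topological_space \<Rightarrow>\<^sub>C 'a) \<Rightarrow> ('x \<Rightarrow>\<^sub>C 'b)"
  where "pointwise_hom \<sigma> f = Bcontfun (\<sigma> \<circ> apply_bcontfun f)"

lemma apply_pointwise_hom:
  assumes "continuous_algebra_hom \<sigma>"
  shows "apply_bcontfun (pointwise_hom \<sigma> f) x = \<sigma> (apply_bcontfun f x)"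
proof -
  have b: "bounded_linear \<sigma>"
    by (rule continuous_algebra_hom_imp_bounded_linear[OF assms])
  have "\<sigma> \<circ> apply_bcontfun f \<in> bcontfun"
    using bounded_linear_image[OF bounded_apply_bcontfun b, of f]
      bounded_linear.continuous_on[OF b continuous_on_apply_bcontfun]
    by (simp add: bcontfun_def image_comp o_def)
  then show ?thesis
    by (simp add: pointwise_hom_def Bcontfun_inverse)
qed

lemma continuous_algebra_hom_pointwise_hom:
  assumes "continuous_algebra_hom \<sigma>"
  shows "continuous_algebra_hom
    (pointwise_hom \<sigma> :: ('x::topological_space \<Rightarrow>\<^sub>C 'a::complex_banach_algebra) \<Rightarrow>
      ('x \<Rightarrow>\<^sub>C 'b::complex_banach_algebra))"
proof -
  let ?S = "pointwise_hom \<sigma> :: ('x \<Rightarrow>\<^sub>C 'a) \<Rightarrow> ('x \<Rightarrow>\<^sub>C 'b)"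
  note app = apply_pointwise_hom[OF assms]
  have b: "bounded_linear \<sigma>"
    by (rule continuous_algebra_hom_imp_bounded_linear[OF assms])
  have S: "clinear ?S"
    using assms unfolding clinear_iff continuous_algebra_hom_def
    by (auto intro!: bcontfun_eqI simp: app scaleC_bcontfun.rep_eq)
  have "norm (?S f) \<le> norm f * onorm \<sigma>" for f
  proof (rule norm_bound)
    show "norm (apply_bcontfun (?S f) x) \<le> norm f * onorm \<sigma>" for x
      using onorm[OF b, of "f x"] mult_left_mono[OF norm_bounded[of f x] onorm_pos_le[OF b]]
      by (simp add: app mult.commute)
  qed
  then have "bounded_linear ?S"
    using clinear_imp_linear[OF S] by (auto simp: bounded_linear_def bounded_linear_axioms_def)
  then have "continuous_on UNIV ?S"
    by (simp add: linear_continuous_on)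
  moreover have "?S (f * g) = ?S f * ?S g" for f g
    using assms unfolding continuous_algebra_hom_def
    by (auto intro!: bcontfun_eqI simp: app times_bcontfun.rep_eq)
  ultimately show ?thesis
    using S by (simp add: continuous_algebra_hom_def)
qed

end

theory Submission
  imports Defs
begin

text \<open>
  Over a commutative algebra the dual bimodule is symmetric, so weak amenability says that every
  derivation into the dual vanishes. Let \<open>D\<close> be a derivation on \<open>C(X, A)\<close>. Pairing
  \<open>D (1 \<otimes> a)\<close> with \<open>h \<otimes> b\<close> for a fixed \<open>h\<close> gives a \<open>\<sigma>\<close>-derivation on \<open>A\<close>, hence \<open>D (1 \<otimes> a) = 0\<close>.
  It follows that \<open>\<sigma>(b) \<cdot> D (u\<^sup>n \<otimes> a) = n u\<^sup>n\<^sup>-\<^sup>1 \<sigma>(b) \<cdot> D (u \<otimes> a)\<close>. For unimodular \<open>u\<close>, multiplying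
  by \<open>u\<^sup>1\<^sup>-\<^sup>n\<close> bounds \<open>n\<close> times \<open>\<sigma>(b) \<cdot> D (u \<otimes> a)\<close> independently of \<open>n\<close>, so it vanishes, and
  the approximate identity removes \<open>\<sigma>(b)\<close>. The tensors \<open>u \<otimes> a\<close> have dense span: pull back a
  partition of unity on the compact set \<open>f(X)\<close> along \<open>f\<close>, and write each function with values in
  \<open>[0, 1]\<close> as the mean of two unimodular ones.
\<close>

section \<open>Commutativity of C(X, A) and its elementary tensors\<close>

instance bcontfun :: (topological_space, "{real_normed_algebra, comm_ring}") comm_ring
  by standard (auto intro!: bcontfun_eqI simp: times_bcontfun.rep_eq mult.commute distrib_right)

lemma bounded_bilinear_scaleC:
  "bounded_bilinear (scaleC :: complex \<Rightarrow> 'a \<Rightarrow> 'a::complex_normed_vector)"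
proof
  fix c d :: complex and x y :: 'a and r :: real
  show "(r *\<^sub>R c) *\<^sub>C x = r *\<^sub>R c *\<^sub>C x" "c *\<^sub>C r *\<^sub>R x = r *\<^sub>R c *\<^sub>C x"
    by (simp_all add: scaleC_scaleC scaleR_conv_of_real mult.commute flip: scaleC_of_real)
  show "\<exists>K. \<forall>(a::complex) (b::'a). norm (a *\<^sub>C b) \<le> norm a * norm b * K"
    by (rule exI[of _ 1]) (simp add: norm_scaleC)
qed (simp_all add: scaleC_add_left scaleC_add_right)

lift_definition tensor_bcontfun ::
    "('x::topological_space \<Rightarrow>\<^sub>C complex) \<Rightarrow> 'a \<Rightarrow> 'x \<Rightarrow>\<^sub>C 'a::complex_normed_vector"  (infixr \<open>\<otimes>\<^sub>C\<close> 72)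
  is "\<lambda>h a x. h x *\<^sub>C a"
proof -
  fix h :: "'x \<Rightarrow> complex" and a :: 'a
  assume h: "h \<in> bcontfun"
  note b = bounded_bilinear.bounded_linear_left[OF bounded_bilinear_scaleC, of a]
  show "(\<lambda>x. h x *\<^sub>C a) \<in> bcontfun"
    using h bounded_linear_image[OF _ b, of "range h"] bounded_linear.continuous_on[OF b]
    by (auto simp: bcontfun_def image_image)
qed

lemmas tensor_apply = tensor_bcontfun.rep_eq

lemma norm_tensor_le: "norm (h \<otimes>\<^sub>C a) \<le> norm h * norm a"
  by (rule norm_bound) (simp add: tensor_apply norm_scaleC mult_right_mono norm_bounded)

lemma bounded_bilinear_tensor: "bounded_bilinear (\<otimes>\<^sub>C)"
proof -
  interpret s: bounded_bilinear "scaleC :: complex \<Rightarrow> 'b \<Rightarrow> 'b"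
    by (rule bounded_bilinear_scaleC)
  show ?thesis
  proof
    show "\<exists>K. \<forall>(h :: 'a \<Rightarrow>\<^sub>C complex) (a::'b). norm (h \<otimes>\<^sub>C a) \<le> norm h * norm a * K"
      by (rule exI[of _ 1]) (simp add: norm_tensor_le)
  qed (auto intro!: bcontfun_eqI
      simp: tensor_apply s.add_left s.add_right s.scaleR_left s.scaleR_right)
qed

lemma tensor_scaleC_right: "h \<otimes>\<^sub>C (c *\<^sub>C a) = c *\<^sub>C (h \<otimes>\<^sub>C a)"
  by (rule bcontfun_eqI) (simp add: tensor_apply scaleC_bcontfun.rep_eq scaleC_scaleC mult.commute)

lemma tensor_mult: "(h \<otimes>\<^sub>C a) * (k \<otimes>\<^sub>C b) = (h * k) \<otimes>\<^sub>C (a * b :: 'a::complex_banach_algebra)"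
  by (rule bcontfun_eqI)
    (simp add: tensor_apply times_bcontfun.rep_eq mult_scaleC_left mult_scaleC_right scaleC_scaleC
      mult.commute)

lemma times_const_bcontfun_1:
  fixes k :: "'x::topological_space \<Rightarrow>\<^sub>C complex"
  shows "const_bcontfun 1 * k = k" "k * const_bcontfun 1 = k"
  by (auto intro!: bcontfun_eqI simp: times_bcontfun.rep_eq)

lemma pointwise_hom_tensor:
  assumes "continuous_algebra_hom \<sigma>"
  shows "pointwise_hom \<sigma> (h \<otimes>\<^sub>C a) = h \<otimes>\<^sub>C \<sigma> a"
  using assms by (intro bcontfun_eqI)
    (simp add: apply_pointwise_hom tensor_apply continuous_algebra_hom_def clinear_iff)

section \<open>Density of the elementary tensors\<close>

lemma tensor_dense:
  fixes f :: "'x::topological_space \<Rightarrow>\<^sub>C 'a::complex_normed_vector"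
  assumes X: "compact (UNIV :: 'x set)"
  shows "f \<in> closure (span {h \<otimes>\<^sub>C a | h a. \<forall>x. \<exists>r\<in>{0..1}. h x = complex_of_real r})"
    (is "f \<in> closure (span ?S)")
  unfolding closure_approachable
proof (intro allI impI)
  fix \<epsilon> :: real
  assume \<epsilon>: "\<epsilon> > 0"
  have "compact (range f)"
    by (rule compact_continuous_image[OF continuous_on_apply_bcontfun X])
  \<comment> \<open>The radius is half of \<epsilon> because the supremum over \<open>x\<close>
    preserves only a non-strict bound.\<close>
  then obtain N where N: "finite N" "range f \<subseteq> (\<Union>y\<in>N. ball y (\<epsilon>/2))"
    using \<epsilon> by (elim compactE_image[where C = "range f" and f = "\<lambda>y. ball y (\<epsilon>/2)"]) auto
  \<comment> \<open>Tent functions pulled back along \<open>f\<close>: \<open>b y\<close> is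
    positive exactly where \<open>f x\<close> lies in the ball about \<open>y\<close>. The cover
    makes their sum positive, so dividing by it gives a partition of unity.\<close>
  define b where "b y x = max 0 (\<epsilon>/2 - dist (f x) y)" for y x
  define s where "s x = (\<Sum>y\<in>N. b y x)" for x
  have b0: "b y x \<ge> 0" for y x by (simp add: b_def)
  have s: "s x > 0" for x
  proof -
    obtain y where "y \<in> N" "dist y (f x) < \<epsilon>/2" using N(2) by fastforce
    then have "b y x > 0" "y \<in> N" by (auto simp: b_def dist_commute)
    then show ?thesis unfolding s_def using N(1) b0 by (intro sum_pos2) auto
  qed
  define w where "w y x = b y x / s x" for y x
  have w0: "w y x \<ge> 0" for y x using b0 s[of x] by (simp add: w_def)
  have w_sum: "(\<Sum>y\<in>N. w y x) = 1" for x
    using s[of x] by (simp add: w_def s_def flip: sum_divide_distrib)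
  have w1: "w y x \<le> 1" if "y \<in> N" for y x
    unfolding w_sum[of x, symmetric] using that N(1) w0 by (intro member_le_sum) auto
  have cont: "continuous_on UNIV (\<lambda>x. complex_of_real (w y x))" for y
    unfolding w_def s_def b_def
    by (intro continuous_intros) (use s in \<open>auto simp: s_def b_def less_imp_neq[symmetric]\<close>)
  define W where "W y = Bcontfun (\<lambda>x. complex_of_real (w y x))" for y
  have W: "apply_bcontfun (W y) x = complex_of_real (w y x)" for x y
    unfolding W_def by (subst Bcontfun_inverse) (simp_all add: compact_imp_bcontfun[OF X cont])
  define g where "g = (\<Sum>y\<in>N. W y \<otimes>\<^sub>C y)"
  have "W y \<otimes>\<^sub>C y \<in> ?S" if "y \<in> N" for y
    using w0 w1[OF that] by (auto simp: W intro!: exI[of _ "W y"] exI[of _ y])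
  then have "g \<in> span ?S"
    unfolding g_def by (intro span_sum span_base)
  moreover have "dist g f < \<epsilon>"
  proof -
    have "dist (g x) (f x) \<le> \<epsilon>/2" for x
    proof -
      have g: "g x = (\<Sum>y\<in>N. w y x *\<^sub>R y)"
        unfolding g_def using N(1)
        by induction (simp_all add: tensor_apply W scaleC_of_real)
      \<comment> \<open>Since the weights sum to 1, the error is the weighted mean of the
        differences \<open>y - f x\<close>.\<close>
      have "g x - f x = (\<Sum>y\<in>N. w y x *\<^sub>R (y - f x))"
        by (simp add: g scaleR_right_diff_distrib sum_subtractf w_sum flip: scaleR_sum_left)
      also have "norm \<dots> \<le> (\<Sum>y\<in>N. w y x * (\<epsilon>/2))"
      proof (rule sum_norm_le)
        fix y
        show "norm (w y x *\<^sub>R (y - f x)) \<le> w y x * (\<epsilon>/2)"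
        \<comment> \<open>A nonzero weight forces \<open>f x\<close> into the ball about
          \<open>y\<close>; zero weights contribute nothing.\<close>
        proof (cases "w y x = 0")
          case False
          then have "dist (f x) y \<le> \<epsilon>/2" by (auto simp: w_def b_def)
          then show ?thesis
            using w0 by (simp add: dist_norm norm_minus_commute mult_left_mono del: times_divide_eq_right)
        qed simp
      qed
      also have "\<dots> = \<epsilon>/2"
        by (simp only: w_sum mult_1_left flip: sum_distrib_right)
      finally show ?thesis by (simp add: dist_norm)
    qed
    then have "dist g f \<le> \<epsilon>/2" by (rule dist_bound)
    with \<epsilon> show ?thesis by simp
  qed
  ultimately show "\<exists>g\<in>span ?S. dist g f < \<epsilon>" by blast
qed

text \<open>A function \<open>h\<close> with values in \<open>[0, 1]\<close> is the mean of the unimodular functions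
  \<open>h \<plusminus> i \<surd>(1 - h\<^sup>2)\<close>.\<close>

lemma bounded_linear_eq_0_on_unimodular_tensors:
  fixes T :: "('x::topological_space \<Rightarrow>\<^sub>C 'a::complex_normed_vector) \<Rightarrow> 'b::real_normed_vector"
  assumes X: "compact (UNIV :: 'x set)"
    and T: "bounded_linear T"
    and 0: "\<And>u a. (\<And>x. cmod (apply_bcontfun u x) = 1) \<Longrightarrow> T (u \<otimes>\<^sub>C a) = 0"
  shows "T f = 0"
proof -
  interpret T: bounded_linear T by (rule T)
  interpret t: bounded_bilinear "(\<otimes>\<^sub>C) :: ('x \<Rightarrow>\<^sub>C complex) \<Rightarrow> 'a \<Rightarrow> 'x \<Rightarrow>\<^sub>C 'a"
    by (rule bounded_bilinear_tensor)
  let ?S = "{h \<otimes>\<^sub>C a | (h :: 'x \<Rightarrow>\<^sub>C complex) (a::'a). \<forall>x. \<exists>r\<in>{0..1}. h x = complex_of_real r}"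
  have tensor: "T (h \<otimes>\<^sub>C a) = 0"
    if h: "\<forall>x. \<exists>r\<in>{0..1}. apply_bcontfun h x = complex_of_real r" for h and a
  proof -
    \<comment> \<open>The sign \<open>s\<close> selects one of the two points of the unit circle
      with real part \<open>h x\<close>; values in [0, 1] keep the radicand nonnegative.\<close>
    define u where "u s x = Complex (Re (apply_bcontfun h x))
      (s * sqrt (1 - (Re (apply_bcontfun h x))\<^sup>2))" for s x
    have "continuous_on UNIV (u s)" for s
      unfolding u_def Complex_eq by (intro continuous_intros continuous_on_apply_bcontfun)
    then have U: "apply_bcontfun (Bcontfun (u s)) x = u s x" for s x
      by (simp add: Bcontfun_inverse compact_imp_bcontfun[OF X])
    have "cmod (u s x) = 1" if "s\<^sup>2 = 1" for s x
    proof -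
      obtain r where "r \<in> {0..1}" "apply_bcontfun h x = complex_of_real r" using h by blast
      then show ?thesis using that
        by (simp add: u_def cmod_def power_mult_distrib abs_square_le_1)
    qed
    then have z: "T (Bcontfun (u s) \<otimes>\<^sub>C a) = 0" if "s\<^sup>2 = 1" for s
      using that by (intro 0) (simp add: U)
    \<comment> \<open>The imaginary parts for the two signs cancel.\<close>
    have "h = (1/2) *\<^sub>R (Bcontfun (u 1) + Bcontfun (u (-1)))"
    proof (rule bcontfun_eqI)
      fix x
      obtain r where "r \<in> {0..1}" "apply_bcontfun h x = complex_of_real r" using h by blast
      then show "apply_bcontfun h x = apply_bcontfun ((1/2) *\<^sub>R (Bcontfun (u 1) + Bcontfun (u (-1)))) x"
        by (simp add: U u_def complex_eq_iff)
    qed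
    then have "T (h \<otimes>\<^sub>C a) = (1/2) *\<^sub>R (T (Bcontfun (u 1) \<otimes>\<^sub>C a) + T (Bcontfun (u (-1)) \<otimes>\<^sub>C a))"
      by (metis T.add T.scaleR t.add_left t.scaleR_left)
    then show ?thesis by (simp add: z)
  qed
  \<comment> \<open>The kernel of \<open>T\<close> is a closed subspace containing a set with dense
    span.\<close>
  have "T g = 0" if "g \<in> span ?S" for g
    by (rule linear_eq_0_on_span[OF T.linear_axioms _ that]) (auto intro!: tensor)
  then have "span ?S \<subseteq> {g. T g = 0}" by blast
  moreover have "closed {g. T g = 0}"
    by (intro closed_Collect_eq continuous_intros linear_continuous_on T)
  ultimately have "closure (span ?S) \<subseteq> {g. T g = 0}"
    by (rule closure_minimal)
  with tensor_dense[OF X, of f] show ?thesis by blast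
qed

section \<open>Derivations into the dual of a commutative algebra\<close>

lemma dual_lact_eq_dual_ract:
  fixes \<phi> :: "'b::{complex_banach_algebra, comm_ring} cdual"
  shows "dual_lact a \<phi> = dual_ract \<phi> a"
  by (rule cdual_eqI) (simp add: dual_lact.rep_eq dual_ract.rep_eq mult.commute)

lemma bounded_clinear_imp_bounded_linear: "bounded_clinear f \<Longrightarrow> bounded_linear f"
  by (simp add: bounded_clinear_iff)

text \<open>The two actions agree, so the difference defining an inner derivation cancels.\<close>

lemma twisted_weakly_amenable_commutative_iff:
  fixes \<theta> :: "'b::{complex_banach_algebra, comm_ring} \<Rightarrow> 'b"
  shows "twisted_weakly_amenable \<theta> \<longleftrightarrow>
    (\<forall>D. twisted_derivation dual_lact dual_ract \<theta> D \<longrightarrow> (\<forall>a. D a = 0))"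
  by (simp add: twisted_weakly_amenable_def twisted_inner_def dual_lact_eq_dual_ract)

text \<open>The Leibniz rule in scalar form: both actions become multiplication of the
  argument.\<close>

lemma twisted_derivation_dual_apply:
  fixes \<theta> :: "'b::{complex_banach_algebra, comm_ring} \<Rightarrow> 'b"
  assumes "twisted_derivation dual_lact dual_ract \<theta> D"
  shows "cdual_apply (D (a * b)) c = cdual_apply (D a) (\<theta> b * c) + cdual_apply (D b) (\<theta> a * c)"
  using assms by (simp add: twisted_derivation_def plus_cdual.rep_eq dual_lact.rep_eq
      dual_ract.rep_eq mult.commute)

lemma twisted_derivation_const_tensor:
  fixes \<sigma> :: "'a::{complex_banach_algebra, comm_ring} \<Rightarrow> 'a"
    and D :: "('x::topological_space \<Rightarrow>\<^sub>C 'a) \<Rightarrow> ('x \<Rightarrow>\<^sub>C 'a) cdual"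
  assumes X: "compact (UNIV :: 'x set)"
    and \<sigma>: "continuous_algebra_hom \<sigma>" "twisted_weakly_amenable \<sigma>"
    and D: "twisted_derivation dual_lact dual_ract (pointwise_hom \<sigma>) D"
  shows "D (const_bcontfun 1 \<otimes>\<^sub>C a) = 0"
proof -
  let ?one = "const_bcontfun 1 :: 'x \<Rightarrow>\<^sub>C complex"
  interpret t: bounded_bilinear "(\<otimes>\<^sub>C) :: ('x \<Rightarrow>\<^sub>C complex) \<Rightarrow> 'a \<Rightarrow> 'x \<Rightarrow>\<^sub>C 'a"
    by (rule bounded_bilinear_tensor)
  have cD: "bounded_clinear D" using D by (simp add: twisted_derivation_def)
  interpret D: bounded_linear D by (rule bounded_clinear_imp_bounded_linear[OF cD])
  have "cdual_apply (D (?one \<otimes>\<^sub>C a)) (h \<otimes>\<^sub>C b) = 0" for h b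
  proof -
    \<comment> \<open>The derivation from \<open>A\<close> to its dual, obtained by fixing
      \<open>h\<close>. \<open>Cdual\<close> is meaningful only on bounded complex-linear maps,
      which \<open>d\<close> below verifies.\<close>
    define d where "d a = Cdual (\<lambda>b. cdual_apply (D (?one \<otimes>\<^sub>C a)) (h \<otimes>\<^sub>C b))" for a
    have d: "cdual_apply (d a) b = cdual_apply (D (?one \<otimes>\<^sub>C a)) (h \<otimes>\<^sub>C b)" for a b
    proof -
      have "bounded_clinear (\<lambda>b. cdual_apply (D (?one \<otimes>\<^sub>C a)) (h \<otimes>\<^sub>C b))"
        by (simp add: bounded_clinear_iff tensor_scaleC_right cdual_apply_scaleC scaleC_complex_def
            bounded_linear_compose[OF bounded_linear_cdual_apply t.bounded_linear_right])
      then show ?thesis by (simp add: d_def Cdual_inverse)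
    qed
    have "bounded_clinear d"
      unfolding bounded_clinear_def
    proof
      show "clinear d"
        using cD by (auto simp: clinear_iff bounded_clinear_iff d t.add_right D.add
            tensor_scaleC_right plus_cdual.rep_eq scaleC_cdual.rep_eq intro!: cdual_eqI)
      have "norm (d a) \<le> onorm D * norm ?one * norm h * norm a" for a
      proof (rule norm_cdual_bound)
        fix b
        have "cmod (cdual_apply (d a) b) \<le> norm (D (?one \<otimes>\<^sub>C a)) * norm (h \<otimes>\<^sub>C b)"
          unfolding d by (rule norm_cdual)
        also have "\<dots> \<le> (onorm D * (norm ?one * norm a)) * (norm h * norm b)"
          by (intro mult_mono norm_tensor_le order_trans[OF onorm[OF D.bounded_linear_axioms]]
              mult_left_mono onorm_pos_le D.bounded_linear_axioms mult_nonneg_nonneg norm_ge_zero)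
        finally show "cmod (cdual_apply (d a) b) \<le> onorm D * norm ?one * norm h * norm a * norm b"
          by (simp add: mult_ac)
      qed (simp add: onorm_pos_le D.bounded_linear_axioms)
      then show "\<exists>K. \<forall>a. norm (d a) \<le> K * norm a" by blast
    qed
    moreover have "d (a * b) = dual_ract (d a) (\<sigma> b) + dual_lact (\<sigma> a) (d b)" for a b
    proof (rule cdual_eqI)
      fix c
      \<comment> \<open>The constant 1 is idempotent, so tensoring with it is multiplicative; it is
        also absorbed by \<open>h\<close>.\<close>
      have "?one \<otimes>\<^sub>C (a * b) = (?one \<otimes>\<^sub>C a) * (?one \<otimes>\<^sub>C b)"
        by (simp add: tensor_mult times_const_bcontfun_1)
      then have "cdual_apply (d (a * b)) c
        = cdual_apply (D ((?one \<otimes>\<^sub>C a) * (?one \<otimes>\<^sub>C b))) (h \<otimes>\<^sub>C c)"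
        unfolding d by (rule arg_cong[where f = "\<lambda>g. cdual_apply (D g) (h \<otimes>\<^sub>C c)"])
      also have "\<dots> = cdual_apply (dual_ract (d a) (\<sigma> b) + dual_lact (\<sigma> a) (d b)) c"
        unfolding twisted_derivation_dual_apply[OF D] pointwise_hom_tensor[OF \<sigma>(1)]
        by (simp add: d tensor_mult times_const_bcontfun_1 plus_cdual.rep_eq dual_ract.rep_eq dual_lact.rep_eq mult.commute)
      finally show "cdual_apply (d (a * b)) c
        = cdual_apply (dual_ract (d a) (\<sigma> b) + dual_lact (\<sigma> a) (d b)) c" .
    qed
    ultimately have "twisted_derivation dual_lact dual_ract \<sigma> d"
      by (simp add: twisted_derivation_def)
    then have "d a = 0"
      using \<sigma>(2) by (simp add: twisted_weakly_amenable_commutative_iff)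
    then show ?thesis
      using d[of a b] by (simp add: zero_cdual.rep_eq)
  qed
  then have "cdual_apply (D (?one \<otimes>\<^sub>C a)) g = 0" for g
    by (rule bounded_linear_eq_0_on_unimodular_tensors[OF X bounded_linear_cdual_apply])
  then show ?thesis
    by (intro cdual_eqI) (simp add: zero_cdual.rep_eq)
qed

lemma apply_funpow_times_bcontfun:
  "apply_bcontfun (((*) u ^^ n) k) x = apply_bcontfun u x ^ n * (apply_bcontfun k x :: complex)"
  by (induction n) (simp_all add: times_bcontfun.rep_eq mult.assoc)

text \<open>The Leibniz rule for powers, by peeling off one factor \<open>u\<close> at a time. As
  \<open>A\<close> may have no unit, \<open>\<sigma> b\<close> supplies a second element to
  accompany that factor.\<close>

lemma twisted_derivation_power_tensor:
  fixes \<sigma> :: "'a::{complex_banach_algebra, comm_ring} \<Rightarrow> 'a"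
    and D :: "('x::topological_space \<Rightarrow>\<^sub>C 'a) \<Rightarrow> ('x \<Rightarrow>\<^sub>C 'a) cdual"
  assumes X: "compact (UNIV :: 'x set)"
    and \<sigma>: "continuous_algebra_hom \<sigma>" "twisted_weakly_amenable \<sigma>"
    and D: "twisted_derivation dual_lact dual_ract (pointwise_hom \<sigma>) D"
  shows "cdual_apply (D (((*) u ^^ Suc n) (const_bcontfun 1) \<otimes>\<^sub>C a)) (h \<otimes>\<^sub>C (\<sigma> b * c)) =
    of_nat (Suc n) * cdual_apply (D (u \<otimes>\<^sub>C a)) (((*) u ^^ n) h \<otimes>\<^sub>C (\<sigma> b * c))"
proof -
  let ?one = "const_bcontfun 1 :: 'x \<Rightarrow>\<^sub>C complex"
  note deriv = twisted_derivation_dual_apply[OF D]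
  note hom = pointwise_hom_tensor[OF \<sigma>(1)]
  \<comment> \<open>Split off the tensor of 1 and \<open>b\<close>; the Leibniz term in which
    \<open>D\<close> hits it vanishes.\<close>
  have shift: "cdual_apply (D (k \<otimes>\<^sub>C (a * b))) (h \<otimes>\<^sub>C c) = cdual_apply (D (k \<otimes>\<^sub>C a)) (h \<otimes>\<^sub>C (\<sigma> b * c))"
    for k h a b c
  proof -
    have "k \<otimes>\<^sub>C (a * b) = (k \<otimes>\<^sub>C a) * (?one \<otimes>\<^sub>C b)"
      by (simp add: tensor_mult times_const_bcontfun_1)
    then have "cdual_apply (D (k \<otimes>\<^sub>C (a * b))) (h \<otimes>\<^sub>C c)
      = cdual_apply (D ((k \<otimes>\<^sub>C a) * (?one \<otimes>\<^sub>C b))) (h \<otimes>\<^sub>C c)"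
      by (rule arg_cong[where f = "\<lambda>g. cdual_apply (D g) (h \<otimes>\<^sub>C c)"])
    also have "\<dots> = cdual_apply (D (k \<otimes>\<^sub>C a)) (h \<otimes>\<^sub>C (\<sigma> b * c))"
      unfolding deriv hom by (simp only: tensor_mult times_const_bcontfun_1 zero_cdual.rep_eq
          twisted_derivation_const_tensor[OF X \<sigma> D] add_0_right)
    finally show ?thesis .
  qed
  have swap: "cdual_apply (D (k \<otimes>\<^sub>C b)) (h \<otimes>\<^sub>C (\<sigma> a * c)) = cdual_apply (D (k \<otimes>\<^sub>C a)) (h \<otimes>\<^sub>C (\<sigma> b * c))"
    for k h
    unfolding shift[symmetric] by (simp only: mult.commute)
  show ?thesis
  \<comment> \<open>\<open>h\<close> must vary: the hypothesis is applied to
    \<open>u * h\<close>.\<close>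
  proof (induction n arbitrary: h)
    case 0
    then show ?case by (simp add: times_const_bcontfun_1)
  next
    case (Suc n)
    let ?p = "((*) u ^^ Suc n) ?one"
    have p: "?p * h = ((*) u ^^ Suc n) h" for h
      by (rule bcontfun_eqI) (simp add: apply_funpow_times_bcontfun times_bcontfun.rep_eq
          del: funpow.simps)
    have comm: "((*) u ^^ n) (u * h) = ((*) u ^^ Suc n) h"
      by (rule bcontfun_eqI) (simp add: apply_funpow_times_bcontfun times_bcontfun.rep_eq mult_ac
          del: funpow.simps)
    have "cdual_apply (D (((*) u ^^ Suc (Suc n)) ?one \<otimes>\<^sub>C a)) (h \<otimes>\<^sub>C (\<sigma> b * c))
      = cdual_apply (D ((u \<otimes>\<^sub>C b) * (?p \<otimes>\<^sub>C a))) (h \<otimes>\<^sub>C c)"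
      unfolding shift[symmetric] tensor_mult by (simp add: mult.commute)
    also have "\<dots> = cdual_apply (D (u \<otimes>\<^sub>C b)) ((?p * h) \<otimes>\<^sub>C (\<sigma> a * c))
        + cdual_apply (D (?p \<otimes>\<^sub>C a)) ((u * h) \<otimes>\<^sub>C (\<sigma> b * c))"
      unfolding deriv hom by (simp only: tensor_mult)
    \<comment> \<open>\<open>swap\<close> makes the first summand one copy of the target value; the
      induction hypothesis turns the second into \<open>Suc n\<close> further copies.\<close>
    also have "\<dots> = of_nat (Suc (Suc n)) *
        cdual_apply (D (u \<otimes>\<^sub>C a)) (((*) u ^^ Suc n) h \<otimes>\<^sub>C (\<sigma> b * c))"
      unfolding Suc.IH p comm swap by (simp add: algebra_simps)
    finally show ?case .
  qed
qed

lemma twisted_derivation_unimodular_tensor: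
  fixes \<sigma> :: "'a::{complex_banach_algebra, comm_ring} \<Rightarrow> 'a"
    and D :: "('x::topological_space \<Rightarrow>\<^sub>C 'a) \<Rightarrow> ('x \<Rightarrow>\<^sub>C 'a) cdual"
  assumes X: "compact (UNIV :: 'x set)"
    and \<sigma>: "continuous_algebra_hom \<sigma>" "twisted_weakly_amenable \<sigma>"
    and D: "twisted_derivation dual_lact dual_ract (pointwise_hom \<sigma>) D"
    and u: "\<And>x. cmod (apply_bcontfun u x) = 1"
  shows "cdual_apply (D (u \<otimes>\<^sub>C a)) (h \<otimes>\<^sub>C (\<sigma> b * c)) = 0" (is "?z = 0")
proof -
  have bD: "bounded_linear D"
    using D by (simp add: twisted_derivation_def bounded_clinear_imp_bounded_linear)
  \<comment> \<open>The pointwise inverse of the unimodular \<open>u\<close>.\<close>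
  define v where "v = Bcontfun (\<lambda>x. cnj (apply_bcontfun u x))"
  have v: "apply_bcontfun v x = cnj (apply_bcontfun u x)" for x
    unfolding v_def
    by (subst Bcontfun_inverse) (auto intro!: compact_imp_bcontfun[OF X] continuous_intros
        continuous_on_apply_bcontfun)
  let ?one = "const_bcontfun 1 :: 'x \<Rightarrow>\<^sub>C complex"
  let ?K = "onorm D * norm a * (norm h * norm (\<sigma> b * c))"
  \<comment> \<open>Testing the power formula against v^n h restores \<open>h\<close> on the right,
    while the powers of \<open>u\<close> and \<open>v\<close> have norm at most 1, so the bound
    \<open>?K\<close> does not grow with \<open>n\<close>.\<close>
  have bd: "of_nat (Suc n) * cmod ?z \<le> ?K" for n
  proof -
    let ?p = "((*) u ^^ Suc n) ?one" and ?k = "((*) v ^^ n) h"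
    have "((*) u ^^ n) ?k = h"
    proof (rule bcontfun_eqI)
      fix x
      have "apply_bcontfun u x * cnj (apply_bcontfun u x) = 1"
        using u[of x] by (simp add: complex_norm_square[symmetric])
      then show "apply_bcontfun (((*) u ^^ n) ?k) x = apply_bcontfun h x"
        by (simp add: apply_funpow_times_bcontfun v mult.assoc[symmetric] power_mult_distrib[symmetric])
    qed
    then have "of_nat (Suc n) * ?z = cdual_apply (D (?p \<otimes>\<^sub>C a)) (?k \<otimes>\<^sub>C (\<sigma> b * c))"
      unfolding twisted_derivation_power_tensor[OF X \<sigma> D] by simp
    then have "of_nat (Suc n) * cmod ?z = cmod (cdual_apply (D (?p \<otimes>\<^sub>C a)) (?k \<otimes>\<^sub>C (\<sigma> b * c)))"
      by (metis norm_mult norm_of_nat)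
    also have "\<dots> \<le> norm (D (?p \<otimes>\<^sub>C a)) * norm (?k \<otimes>\<^sub>C (\<sigma> b * c))"
      by (rule norm_cdual)
    also have "\<dots> \<le> ?K"
    proof (rule mult_mono)
      have "norm ?p \<le> 1"
        by (rule norm_bound) (simp add: apply_funpow_times_bcontfun norm_mult norm_power u
            del: funpow.simps)
      then have "norm (?p \<otimes>\<^sub>C a) \<le> norm a"
        using norm_tensor_le[of ?p a] mult_right_mono[of "norm ?p" 1 "norm a"] by simp
      then show "norm (D (?p \<otimes>\<^sub>C a)) \<le> onorm D * norm a"
        using onorm[OF bD, of "?p \<otimes>\<^sub>C a"] mult_left_mono onorm_pos_le[OF bD] order_trans by blast
      have "norm ?k \<le> norm h"
        by (rule norm_bound) (simp add: apply_funpow_times_bcontfun norm_mult norm_power u v norm_bounded)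
      then show "norm (?k \<otimes>\<^sub>C (\<sigma> b * c)) \<le> norm h * norm (\<sigma> b * c)"
        using norm_tensor_le order_trans mult_right_mono norm_ge_zero by meson
    qed (simp_all add: onorm_pos_le[OF bD])
    finally show ?thesis .
  qed
  show ?thesis
  proof (rule ccontr)
    assume "?z \<noteq> 0"
    \<comment> \<open>The Archimedean property; \<open>n\<close> is then raised to
      \<open>Suc n\<close>, the form in which the bound is available.\<close>
    then obtain n where "?K < of_nat n * cmod ?z"
      using ex_less_of_nat_mult[of "cmod ?z" ?K] by auto
    also have "\<dots> \<le> of_nat (Suc n) * cmod ?z" by (intro mult_right_mono) auto
    finally show False using bd[of n] by simp
  qed
qed

theorem proposition3p2:
  fixes \<sigma> :: "'a::{complex_banach_algebra, comm_ring} \<Rightarrow> 'a"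
    and e :: "'i \<Rightarrow> 'a" and I :: "'i set" and le :: "'i \<Rightarrow> 'i \<Rightarrow> bool"
  assumes "compact (UNIV :: 'x::t2_space set)"
    and "continuous_algebra_hom \<sigma>"
    and "closure (range \<sigma>) = UNIV"
    and "directed_set I le"
    and "bounded (e ` I)"
    and "bounded_approximate_identity I le (\<lambda>v. \<sigma> (e v))"
    and "twisted_weakly_amenable \<sigma>"
  shows "twisted_weakly_amenable (pointwise_hom \<sigma> :: ('x \<Rightarrow>\<^sub>C 'a) \<Rightarrow> ('x \<Rightarrow>\<^sub>C 'a))"
  unfolding twisted_weakly_amenable_commutative_iff
proof (intro allI impI)
  fix D :: "('x \<Rightarrow>\<^sub>C 'a) \<Rightarrow> ('x \<Rightarrow>\<^sub>C 'a) cdual" and f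
  assume D: "twisted_derivation dual_lact dual_ract (pointwise_hom \<sigma>) D"
  interpret t: bounded_bilinear "(\<otimes>\<^sub>C) :: ('x \<Rightarrow>\<^sub>C complex) \<Rightarrow> 'a \<Rightarrow> 'x \<Rightarrow>\<^sub>C 'a"
    by (rule bounded_bilinear_tensor)
  \<comment> \<open>Every tail of a directed set is nonempty, so limits along the net are
    unique.\<close>
  have nontriv: "net_filter I le \<noteq> bot"
    using assms(4) unfolding trivial_limit_def eventually_net_filter[OF assms(4)] directed_set_def
    by blast
  have "D (u \<otimes>\<^sub>C a) = 0" if u: "\<And>x. cmod (apply_bcontfun u x) = 1" for u a
  proof (rule cdual_eqI)
    fix g
    let ?T = "cdual_apply (D (u \<otimes>\<^sub>C a))"
    \<comment> \<open>The values at \<open>\<sigma> (e v) * c\<close> all vanish and converge to the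
      value at \<open>c\<close>.\<close>
    have "?T (h \<otimes>\<^sub>C c) = 0" for h c
    proof (rule tendsto_unique[OF nontriv])
      have "((\<lambda>v. \<sigma> (e v) * c) \<longlongrightarrow> c) (net_filter I le)"
        using assms(6) by (simp add: bounded_approximate_identity_def)
      then show "((\<lambda>v. ?T (h \<otimes>\<^sub>C (\<sigma> (e v) * c))) \<longlongrightarrow> ?T (h \<otimes>\<^sub>C c)) (net_filter I le)"
        by (intro bounded_linear.tendsto[OF bounded_linear_cdual_apply]
            bounded_linear.tendsto[OF t.bounded_linear_right])
      show "((\<lambda>v. ?T (h \<otimes>\<^sub>C (\<sigma> (e v) * c))) \<longlongrightarrow> 0) (net_filter I le)"
        by (simp add: twisted_derivation_unimodular_tensor[OF assms(1,2,7) D u])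
    qed
    then show "?T g = cdual_apply 0 g"
      by (simp add: zero_cdual.rep_eq
          bounded_linear_eq_0_on_unimodular_tensors[OF assms(1) bounded_linear_cdual_apply])
  qed
  moreover have "bounded_linear D"
    using D by (simp add: twisted_derivation_def bounded_clinear_imp_bounded_linear)
  \<comment> \<open>Density is used a second time: first it extended the vanishing of each
    functional \<open>?T\<close>, now that of \<open>D\<close> itself.\<close>
  ultimately show "D f = 0"
    by (rule bounded_linear_eq_0_on_unimodular_tensors[OF assms(1), rotated])
qed

end
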